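(* Let $p$ be a prime. A nonzero rational number $\alpha$ is a zero of a nonzero polynomial whose nonzero coefficients all belong to $\{\pm p^m:m\in\mathbb Z_{\geq 0}\}$ if and only if $\alpha=\pm p^k$ for some $k\in\mathbb Z$.
   Context: Polynomials are in one variable $z$; each coefficient is either $0$ or of the form $\pm p^m$ with $m\geq 0$ an integer. *)

theory Defs
  imports "HOL-Computational_Algebra.Computational_Algebra"
begin

end

theory Submission
  imports Defs
begin

text \<open>
  Write a root as \<open>a / b\<close> in lowest terms. By the rational root theorem, \<open>b\<close> divides the leading
  coefficient, a power of \<open>p\<close> up to sign; applied to the reciprocal polynomial, it shows
  that \<open>a\<close> divides the lowest nonzero coefficient, again a power of \<open>p\<close> up to sign.
\<close>

text \<open>Clearing denominators: multiplying the root equation by \<open>b ^ degree g\<close>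
  gives an integer sum in which every term below the leading one keeps a factor \<open>b\<close>. So
  \<open>b\<close> divides \<open>lead_coeff g * a ^ degree g\<close>, and coprimality removes the
  power of \<open>a\<close>.\<close>

lemma rational_root_denominator_dvd:
  fixes g :: "int poly" and a b :: int
  assumes root: "poly (map_poly rat_of_int g) (rat_of_int a / rat_of_int b) = 0"
    and "coprime a b" and "b \<noteq> 0"
  shows "b dvd lead_coeff g"
proof -
  let ?n = "degree g"
  let ?t = "\<lambda>i. coeff g i * a ^ i * b ^ (?n - i)"
  have scaled: "rat_of_int (?t i) =
      of_int b ^ ?n * (of_int (coeff g i) * (of_int a / of_int b) ^ i)" if "i \<le> ?n" for i
  proof -
    have "rat_of_int b ^ ?n = of_int b ^ i * of_int b ^ (?n - i)"
      using that by (simp flip: power_add)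
    with \<open>b \<noteq> 0\<close> show ?thesis
      by (simp add: power_divide)
  qed
  have "rat_of_int (\<Sum>i\<le>?n. ?t i) =
      (\<Sum>i\<le>?n. of_int b ^ ?n * (of_int (coeff g i) * (of_int a / of_int b) ^ i))"
    unfolding of_int_sum by (rule sum.cong[OF refl]) (rule scaled, simp)
  also have "\<dots> = of_int b ^ ?n * poly (map_poly of_int g) (of_int a / of_int b)"
    by (simp add: poly_altdef degree_map_poly coeff_map_poly sum_distrib_left)
  finally have zero: "(\<Sum>i\<le>?n. ?t i) = 0"
    using root by (simp only: mult_zero_right of_int_eq_0_iff)
  have split: "(\<Sum>i\<le>?n. ?t i) = lead_coeff g * a ^ ?n + (\<Sum>i<?n. ?t i)"
    by (simp add: lessThan_Suc_atMost [symmetric])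
  \<comment> \<open>For \<open>i < ?n\<close> the exponent \<open>?n - i\<close> is
    positive.\<close>
  have "b dvd (\<Sum>i<?n. ?t i)"
    by (intro dvd_sum dvd_mult dvd_power) simp
  then have "b dvd lead_coeff g * a ^ ?n + (\<Sum>i<?n. ?t i) \<longleftrightarrow> b dvd lead_coeff g * a ^ ?n"
    by (rule dvd_add_left_iff)
  then have "b dvd lead_coeff g * a ^ ?n"
    unfolding split [symmetric] zero by simp
  with \<open>coprime a b\<close> show ?thesis
    by (simp add: coprime_dvd_mult_left_iff coprime_commute)
qed

lemma dvd_prime_power_int_cases:
  fixes p :: nat and b c :: int
  assumes "prime p" and "b dvd c" and "c = int p ^ m \<or> c = - (int p ^ m)"
  obtains t where "b = int p ^ t \<or> b = - (int p ^ t)"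
proof -
  have "nat \<bar>b\<bar> dvd p ^ m"
    using assms by (metis dvd_minus_iff nat_abs_dvd_iff of_nat_power)
  then obtain t where "nat \<bar>b\<bar> = p ^ t"
    using \<open>prime p\<close> by (meson divides_primepow_nat)
  then have "\<bar>b\<bar> = int p ^ t"
    by (metis abs_ge_zero nat_0_le of_nat_power)
  then show thesis
    by (intro that[of t]) linarith
qed

text \<open>The exponents \<open>m\<close> are natural numbers, so \<open>f\<close> has integer
  coefficients and the divisibility result applies to it. The sign of \<open>b\<close> is left open
  because the lemma serves twice: for \<open>f\<close> at \<open>a / b\<close>, and for its
  reflection at \<open>b / a\<close>, whose denominator may be negative.\<close>

lemma rational_root_denominator_prime_power:
  fixes p :: nat and f :: "rat poly" and a b :: int
  assumes "prime p" and "f \<noteq> 0"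
    and coeffs: "\<And>i. coeff f i \<noteq> 0 \<Longrightarrow> \<exists>m. coeff f i = of_nat p ^ m \<or> coeff f i = - (of_nat p ^ m)"
    and root: "poly f (rat_of_int a / rat_of_int b) = 0"
    and "coprime a b" and "b \<noteq> 0"
  obtains t where "b = int p ^ t \<or> b = - (int p ^ t)"
proof -
  have "coeff f i \<in> \<int>" for i
    using coeffs[of i] by (cases "coeff f i = 0") auto
  \<comment> \<open>On integer coefficients \<open>floor\<close> inverts \<open>rat_of_int\<close>,
    which yields a preimage of \<open>f\<close> over the integers.\<close>
  then have "map_poly rat_of_int (map_poly floor f) = f"
    by (intro poly_eqI) (simp add: coeff_map_poly)
  then obtain g where g: "f = map_poly rat_of_int g"
    by (intro that) (rule sym)
  with root \<open>coprime a b\<close> \<open>b \<noteq> 0\<close> have dvd: "b dvd lead_coeff g"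
    by (simp add: rational_root_denominator_dvd)
  have lead: "lead_coeff f = rat_of_int (lead_coeff g)"
    by (simp add: g degree_map_poly coeff_map_poly)
  obtain m where "lead_coeff f = of_nat p ^ m \<or> lead_coeff f = - (of_nat p ^ m)"
    using coeffs[of "degree f"] \<open>f \<noteq> 0\<close> by auto
  then have "lead_coeff g = int p ^ m \<or> lead_coeff g = - (int p ^ m)"
    unfolding lead by (metis of_int_eq_iff of_int_minus of_int_of_nat_eq of_int_power)
  with \<open>prime p\<close> dvd show thesis
    by (rule dvd_prime_power_int_cases) (rule that)
qed

text \<open>A linear polynomial suffices: the numerator and the denominator of the root, up to sign,
  are its two coefficients.\<close>

lemma power_int_root_poly:
  fixes p :: nat and k :: int and \<epsilon> :: rat
  assumes "p > 0" and "\<epsilon> = 1 \<or> \<epsilon> = -1"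
  obtains f :: "rat poly" where "f \<noteq> 0"
    and "\<And>i. coeff f i \<noteq> 0 \<Longrightarrow> \<exists>m. coeff f i = of_nat p ^ m \<or> coeff f i = - (of_nat p ^ m)"
    and "poly f (\<epsilon> * of_nat p powi k) = 0"
proof
  \<comment> \<open>\<open>nat\<close> sends negative integers to 0, so at least one of the two
    powers is 1 and their quotient is \<open>of_nat p powi k\<close> for either sign of
    \<open>k\<close>.\<close>
  let ?f = "[: - \<epsilon> * of_nat p ^ nat k, of_nat p ^ nat (- k) :] :: rat poly"
  show "?f \<noteq> 0"
    using \<open>p > 0\<close> by simp
  show "\<exists>m. coeff ?f i = of_nat p ^ m \<or> coeff ?f i = - (of_nat p ^ m)" if "coeff ?f i \<noteq> 0" for i
    using that assms(2)
    by (auto simp: coeff_pCons split: nat.splits intro: exI[of _ "nat k"] exI[of _ "0::nat"])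
  show "poly ?f (\<epsilon> * of_nat p powi k) = 0"
    using \<open>p > 0\<close> by (cases "k \<ge> 0") (simp_all add: power_int_def field_simps)
qed

theorem corollary4p2:
  fixes p :: nat and \<alpha> :: rat
  assumes "prime p" and "\<alpha> \<noteq> 0"
  shows "(\<exists>f :: rat poly. f \<noteq> 0
            \<and> (\<forall>i. coeff f i \<noteq> 0 \<longrightarrow>
                  (\<exists>m :: nat. coeff f i = of_nat p ^ m \<or> coeff f i = - (of_nat p ^ m)))
            \<and> poly f \<alpha> = 0)
         \<longleftrightarrow> (\<exists>k :: int. \<alpha> = of_nat p powi k \<or> \<alpha> = - (of_nat p powi k))"
proof
  assume "\<exists>f :: rat poly. f \<noteq> 0
            \<and> (\<forall>i. coeff f i \<noteq> 0 \<longrightarrow>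
                  (\<exists>m :: nat. coeff f i = of_nat p ^ m \<or> coeff f i = - (of_nat p ^ m)))
            \<and> poly f \<alpha> = 0"
  then obtain f :: "rat poly" where "f \<noteq> 0" and root: "poly f \<alpha> = 0"
    and coeffs: "\<And>i. coeff f i \<noteq> 0 \<Longrightarrow>
                  \<exists>m :: nat. coeff f i = of_nat p ^ m \<or> coeff f i = - (of_nat p ^ m)"
    by blast
  obtain a b where "quotient_of \<alpha> = (a, b)"
    by fastforce
  then have \<alpha>: "\<alpha> = of_int a / of_int b" and "coprime a b" and "b > 0"
    by (simp_all add: quotient_of_div quotient_of_coprime quotient_of_denom_pos)
  with \<open>\<alpha> \<noteq> 0\<close> have "a \<noteq> 0" and "b \<noteq> 0"
    by auto
  obtain t where t: "b = int p ^ t \<or> b = - (int p ^ t)"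
    using rational_root_denominator_prime_power[OF \<open>prime p\<close> \<open>f \<noteq> 0\<close> coeffs
        root[unfolded \<alpha>] \<open>coprime a b\<close> \<open>b \<noteq> 0\<close>] .
  \<comment> \<open>Reversing the coefficients makes the lowest nonzero coefficient of
    \<open>f\<close> the leading one, even when \<open>f\<close> vanishes at 0, and turns the root
    \<alpha> into its inverse. The numerator \<open>a\<close> thereby becomes a denominator.\<close>
  have nonzero: "reflect_poly f \<noteq> 0"
    using \<open>f \<noteq> 0\<close> by simp
  have reflect_coeffs:
    "\<exists>m. coeff (reflect_poly f) i = of_nat p ^ m \<or> coeff (reflect_poly f) i = - (of_nat p ^ m)"
    if "coeff (reflect_poly f) i \<noteq> 0" for i
    using that coeffs by (simp add: coeff_reflect_poly split: if_splits)
  have reflect_root: "poly (reflect_poly f) (of_int b / of_int a) = 0"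
    using root \<open>\<alpha> \<noteq> 0\<close> poly_reflect_poly_nz[of "inverse \<alpha>" f] by (simp add: \<alpha>)
  have "coprime b a"
    using \<open>coprime a b\<close> by (simp add: coprime_commute)
  obtain s where s: "a = int p ^ s \<or> a = - (int p ^ s)"
    using rational_root_denominator_prime_power[OF \<open>prime p\<close> nonzero reflect_coeffs
        reflect_root \<open>coprime b a\<close> \<open>a \<noteq> 0\<close>] .
  have "of_nat p powi (int s - int t) = (of_nat p ^ s / of_nat p ^ t :: rat)"
    using \<open>prime p\<close> by (simp add: power_int_diff prime_gt_0_nat)
  with s t have "\<alpha> = of_nat p powi (int s - int t) \<or> \<alpha> = - (of_nat p powi (int s - int t))"
    by (auto simp: \<alpha>)
  then show "\<exists>k :: int. \<alpha> = of_nat p powi k \<or> \<alpha> = - (of_nat p powi k)" ..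
next
  assume "\<exists>k :: int. \<alpha> = of_nat p powi k \<or> \<alpha> = - (of_nat p powi k)"
  \<comment> \<open>The sign becomes a factor \<epsilon>, so that one witness covers both
    cases.\<close>
  then obtain k \<epsilon> where \<epsilon>: "\<epsilon> = 1 \<or> \<epsilon> = -1" and \<alpha>: "\<alpha> = \<epsilon> * of_nat p powi k"
    by (metis mult_1 mult_minus1)
  obtain f :: "rat poly" where "f \<noteq> 0"
    and "\<And>i. coeff f i \<noteq> 0 \<Longrightarrow> \<exists>m. coeff f i = of_nat p ^ m \<or> coeff f i = - (of_nat p ^ m)"
    and "poly f \<alpha> = 0"
    using power_int_root_poly[OF prime_gt_0_nat[OF \<open>prime p\<close>] \<epsilon>, of k, folded \<alpha>] by blast
  then show "\<exists>f :: rat poly. f \<noteq> 0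
            \<and> (\<forall>i. coeff f i \<noteq> 0 \<longrightarrow>
                  (\<exists>m :: nat. coeff f i = of_nat p ^ m \<or> coeff f i = - (of_nat p ^ m)))
            \<and> poly f \<alpha> = 0"
    by blast
qed

end
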